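(* For integers $0\le k\le n$, let $B(n,k)=\sum_{i=k}^n(-1)^{k-i}2^{n-i}\binom{n}{i}$. Then $$B(n,k)=\sum_{\substack{\pi\in\widehat{\mathcal{Q}}_{n+1}\\ \mathrm{exc}(\pi)=n-k}}(-1)^{\mathrm{cyc}(\pi)+\mathrm{aexc}(\pi)}.$$
   Context: For $\pi\in\mathfrak{S}_m$: $\mathrm{exc}(\pi)=|\{i:\pi(i)>i\}|$, $\mathrm{aexc}(\pi)=|\{i:\pi(i)\le i\}|$, and $\mathrm{cyc}(\pi)$ is the number of cycles. $\widehat{\mathcal{Q}}_m$ is the set of $\pi\in\mathfrak{S}_m$ whose cycle containing $m$, written as $(c_1,\dots,c_k,m)$ ending with $m$ (i.e. $\pi(c_i)=c_{i+1}$, $\pi(c_k)=m$, $\pi(m)=c_1$), satisfies $c_1<c_2<\cdots<c_k$ (possibly $k=0$). *)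

theory Defs
  imports "HOL-Combinatorics.Orbits"
begin

(* A permutation of {1..m} is a function p :: nat => nat with p permutes {1..m}. As such a p fixes
   every number outside {1..m}, the statistics below are restricted to {1..m}. *)

definition exc :: "nat \<Rightarrow> (nat \<Rightarrow> nat) \<Rightarrow> nat" where
  "exc m p = card {i \<in> {1..m}. p i > i}"

definition aexc :: "nat \<Rightarrow> (nat \<Rightarrow> nat) \<Rightarrow> nat" where
  "aexc m p = card {i \<in> {1..m}. p i \<le> i}"

(* Fixed points count as cycles: if p i = i, then orbit p i = {i}. *)
definition cyc :: "nat \<Rightarrow> (nat \<Rightarrow> nat) \<Rightarrow> nat" where
  "cyc m p = card (orbit p ` {1..m})"

(* For cs = [c_1, ..., c_k], the equation with rotate1 says p c_1 = c_2, ..., p c_k = m and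
   p m = c_1 (or p m = m if k = 0), so that (c_1, ..., c_k, m) is the cycle of p containing m. *)
definition Qhat :: "nat \<Rightarrow> (nat \<Rightarrow> nat) set" where
  "Qhat m = {p. p permutes {1..m} \<and>
     (\<exists>cs. distinct (cs @ [m]) \<and> map p (cs @ [m]) = rotate1 (cs @ [m]) \<and> sorted_wrt (<) cs)}"

(* The exponent is i - k rather than k - i: the sign is the same, and i - k is a natural number. *)
definition B :: "nat \<Rightarrow> nat \<Rightarrow> int" where
  "B n k = (\<Sum>i=k..n. (-1) ^ (i - k) * 2 ^ (n - i) * int (n choose i))"

end

theory Submission
  imports Defs "HOL-Combinatorics.Cycles" "HOL-Computational_Algebra.Polynomial"
begin

text \<open>
  Give a permutation \<open>p\<close> the weight \<open>(-1)\<^bsup>cyc\<^esup> t\<^bsup>exc\<^esup>\<close>. Inserting a new largest element, either as a fixed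
  point or after an element \<open>c\<close> of an existing cycle (a new excedance at \<open>c\<close> unless there already was one),
  gives the total weight \<open>P\<^sub>m\<close> of all permutations of an \<open>m\<close>-set an Eulerian-type recurrence
  \<open>P\<^bsub>m + 1\<^esub> = (m t - 1) P\<^sub>m + t (1 - t) P\<^sub>m'\<close>, so \<open>P\<^sub>m = - (t - 1)\<^bsup>m - 1\<^esup>\<close> for \<open>m \<ge> 1\<close>.

  An element of \<open>Qhat (n + 1)\<close> is a subset \<open>S\<close> of \<open>{1..n}\<close>, the increasing cycle on \<open>S \<union> {n + 1}\<close>, and an
  arbitrary permutation of the rest. Hence its generating polynomial is
  \<open>G = - \<Sum>\<^sub>S t\<^bsup>card S\<^esup> P\<^bsub>n - card S\<^esub>\<close>, and the binomial theorem gives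
  \<open>(t - 1) G = (2 t - 1)\<^sup>n - t\<^bsup>n + 1\<^esup>\<close>. On coefficients this is the recurrence
  \<open>B n k + B n (k + 1) = 2\<^bsup>n - k\<^esup> (n choose k)\<close>; as \<open>exc + aexc = n + 1\<close>, the factor \<open>(-1)\<^bsup>aexc\<^esup>\<close> is constant.
\<close>

section \<open>Cycles and excedances under insertion of a new element\<close>

definition excedances :: "nat set \<Rightarrow> (nat \<Rightarrow> nat) \<Rightarrow> nat" where
  "excedances A p = card {i \<in> A. i < p i}"

definition num_cycles :: "'a set \<Rightarrow> ('a \<Rightarrow> 'a) \<Rightarrow> nat" where
  "num_cycles A p = card (orbit p ` A)"

definition weight :: "nat set \<Rightarrow> (nat \<Rightarrow> nat) \<Rightarrow> int poly" where
  "weight A p = monom ((- 1) ^ num_cycles A p) (excedances A p)"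

lemma num_cycles_insert_fixed:
  assumes "q permutes S" "finite S" "a \<notin> S"
  shows "num_cycles (insert a S) q = Suc (num_cycles S q)"
proof -
  have "orbit q a = {a}"
    using assms by (simp add: orbit_eq_singleton_iff permutes_not_in)
  moreover have "{a} \<notin> orbit q ` S"
    using permutes_orbit_subset[OF assms(1)] assms(3) by blast
  ultimately show ?thesis
    using assms(2) by (simp add: num_cycles_def)
qed

text \<open>The permutation \<open>q(c := a, a := q c)\<close> arises from \<open>q\<close> by inserting \<open>a\<close> after \<open>c\<close> in the cycle of \<open>c\<close>.\<close>

lemma orbit_insert_after:
  assumes q: "q permutes S" and S: "finite S" "a \<notin> S" and c: "c \<in> S" and x: "x \<in> S"
  shows "orbit (q(c := a, a := q c)) x = (if c \<in> orbit q x then insert a (orbit q x) else orbit q x)"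
    (is "orbit ?r x = ?O")
proof (intro set_eqI iffI)
  have self: "z \<in> orbit q z" for z
    using q S(1) by (meson permutation_permutes permutation_self_in_orbit)
  have ca: "c \<noteq> a" and xa: "x \<noteq> a" using c x S by auto
  have r: "?r c = a" "?r a = q c" "\<And>z. z \<noteq> c \<Longrightarrow> z \<noteq> a \<Longrightarrow> ?r z = q z"
    using ca by auto
  fix y
  show "y \<in> ?O" if "y \<in> orbit ?r x"
    using that
  proof induction
    case base
    show ?case using self[of c] xa by (auto intro: orbit.base)
  next
    case (step y)
    moreover have "a \<notin> orbit q x" using permutes_orbit_subset[OF q x] S(2) by auto
    ultimately show ?case using ca by (auto split: if_splits intro: orbit.step)
  qed
  \<comment> \<open>Where the path of \<open>q\<close> leaves \<open>c\<close>, the new permutation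
    takes two steps, passing through \<open>a\<close>; elsewhere the two agree.\<close>
  have sub: "z \<in> orbit ?r x" if "z \<in> orbit q x" for z
    using that
  proof induction
    case base
    show ?case
    proof (cases "x = c")
      case True
      have "?r (?r x) \<in> orbit ?r x" by (intro orbit.intros)
      then show ?thesis by (simp only: True r)
    next
      case False
      then have "?r x = q x" using xa by (rule r(3))
      then show ?thesis using orbit.base[of ?r x] by (simp only:)
    qed
  next
    case (step y)
    have ya: "y \<noteq> a" using permutes_orbit_subset[OF q x] step.hyps S(2) by auto
    show ?case
    proof (cases "y = c")
      case True
      have "?r (?r y) \<in> orbit ?r x" by (intro orbit.step step.IH)
      then show ?thesis by (simp only: True r)
    next
      case False
      then have "?r y = q y" using ya by (rule r(3))
      then show ?thesis using orbit.step[OF step.IH] by (simp only:)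
    qed
  qed
  show "y \<in> orbit ?r x" if "y \<in> ?O"
  proof (cases "y \<in> orbit q x")
    case True
    then show ?thesis by (rule sub)
  next
    case False
    then have *: "y = a" "c \<in> orbit q x" using that by (auto split: if_splits)
    show ?thesis using orbit.step[OF sub[OF *(2)]] by (simp only: *(1) r)
  qed
qed

text \<open>The new element \<open>a\<close> joins the orbit of \<open>c\<close>. The map
  \<open>g\<close> that enlarges this orbit and keeps the others is injective, because no old orbit
  contains \<open>a\<close>.\<close>

lemma num_cycles_insert_after:
  assumes q: "q permutes S" and S: "finite S" "a \<notin> S" and c: "c \<in> S"
  shows "num_cycles (insert a S) (q(c := a, a := q c)) = num_cycles S q"
    (is "num_cycles _ ?r = _")
proof -
  define g where "g X = (if c \<in> X then insert a X else X)" for X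
  have "permutation q" using q S by (auto simp: permutation_permutes)
  have "orbit ?r a = orbit ?r c"
  proof -
    have ca: "c \<noteq> a" using c S by auto
    have "c \<in> orbit q c" using \<open>permutation q\<close> by (rule permutation_self_in_orbit)
    then have "c \<in> orbit ?r c" by (simp add: orbit_insert_after[OF q S c c])
    then have "orbit ?r (?r c) = orbit ?r c" by (rule self_in_orbit_step)
    then show ?thesis using ca by simp
  qed
  then have "orbit ?r ` insert a S = orbit ?r ` S" using c by auto
  also have "\<dots> = g ` orbit q ` S"
    unfolding image_image g_def using orbit_insert_after[OF q S c] by (intro image_cong) auto
  finally have "num_cycles (insert a S) ?r = card (g ` orbit q ` S)"
    by (simp add: num_cycles_def)
  also have "inj_on g (orbit q ` S)"
  proof (rule inj_onI)
    fix X Y assume "X \<in> orbit q ` S" "Y \<in> orbit q ` S" and g: "g X = g Y"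
    then have "a \<notin> X" "a \<notin> Y" using permutes_orbit_subset[OF q] S by auto
    then show "X = Y" using g by (auto simp: g_def split: if_splits)
  qed
  then have "card (g ` orbit q ` S) = num_cycles S q"
    by (simp add: num_cycles_def card_image)
  finally show ?thesis .
qed

lemma excedances_insert_fixed:
  assumes "q permutes S" "a \<notin> S"
  shows "excedances (insert a S) q = excedances S q"
  unfolding excedances_def using permutes_not_in[OF assms]
  by (intro arg_cong[of _ _ card]) auto

text \<open>The point \<open>c\<close> now maps to the maximum \<open>a\<close>, so it becomes an
  excedance if it was not one; \<open>a\<close> maps to \<open>q c < a\<close> and is none; all
  other values are unchanged.\<close>

lemma excedances_insert_after:
  assumes q: "q permutes S" and S: "finite S" "\<forall>x\<in>S. x < a" and c: "c \<in> S"
  shows "excedances (insert a S) (q(c := a, a := q c)) =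
    (if c < q c then excedances S q else Suc (excedances S q))"
proof -
  have "q c < a" using permutes_in_image[OF q, of c] S c by auto
  then have "{i \<in> insert a S. i < (q(c := a, a := q c)) i} = insert c {i \<in> S. i < q i}"
    using S(2) c by (auto simp: fun_upd_apply split: if_splits)
  then show ?thesis using S(1) c
    by (auto simp: excedances_def card_insert_if)
qed

text \<open>The fixed point costs a sign, insertion after an excedance keeps the weight, and
  insertion after any other point multiplies it by \<open>t\<close>. The number of excedances enters
  through the operator \<open>t d/dt\<close>, which multiplies a monomial by its exponent.\<close>

lemma sum_weight_insert_max:
  assumes q: "q permutes S" and S: "finite S" "\<forall>x\<in>S. x < a"
  shows "(\<Sum>b\<in>insert a S. weight (insert a S) (transpose a b \<circ> q)) =
    (of_nat (card S) * [:0, 1:] - 1) * weight S q + [:0, 1:] * (1 - [:0, 1:]) * pderiv (weight S q)"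
proof -
  have a: "a \<notin> S" using S(2) by auto
  define w where "w = weight S q"
  define E where "E = {i \<in> S. i < q i}"
  have E: "E \<subseteq> S" "excedances S q = card E" by (auto simp: E_def excedances_def)
  have X: "[:0, 1:] * w = monom ((- 1) ^ num_cycles S q) (Suc (excedances S q))"
    by (simp add: w_def weight_def monom_Suc)
  have XD: "[:0, 1:] * pderiv w = of_nat (card E) * w"
    unfolding w_def weight_def E(2) pderiv_monom
    by (cases "card E") (simp_all add: of_nat_monom mult_monom flip: monom_Suc)
  have c: "weight (insert a S) (transpose a (q c) \<circ> q) = (if c \<in> E then w else [:0, 1:] * w)"
    if "c \<in> S" for c
  proof -
    \<comment> \<open>Swapping the values \<open>a\<close> and \<open>q c\<close> affects only the
      arguments \<open>a\<close> and \<open>c\<close>, since \<open>q\<close> is injective and fixes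
      \<open>a\<close>.\<close>
    have "(transpose a (q c) \<circ> q) = q(c := a, a := q c)"
    proof
      fix x
      show "(transpose a (q c) \<circ> q) x = (q(c := a, a := q c)) x"
        using a that permutes_not_in[OF q a] permutes_inj[OF q, THEN injD, of x c]
          permutes_inj[OF q, THEN injD, of x a]
          permutes_in_image[OF q, of x]
        by (cases "x = a"; cases "x = c"; auto simp: transpose_def)
    qed
    then show ?thesis
      using excedances_insert_after[OF q S that] num_cycles_insert_after[OF q S(1) a that] that
      by (simp add: weight_def X E_def) (simp add: w_def weight_def monom_Suc)
  qed
  have "(\<Sum>b\<in>insert a S. weight (insert a S) (transpose a b \<circ> q)) =
      weight (insert a S) q + (\<Sum>b\<in>S. weight (insert a S) (transpose a b \<circ> q))"
    using S(1) a by simp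
  also have "weight (insert a S) q = - w"
    unfolding weight_def w_def num_cycles_insert_fixed[OF q S(1) a] excedances_insert_fixed[OF q a]
    by (simp add: minus_monom)
  \<comment> \<open>Each \<open>b\<close> in \<open>S\<close> is \<open>q c\<close> for a unique
    \<open>c\<close>; indexing by \<open>c\<close> names the point after which \<open>a\<close> is
    inserted.\<close>
  also have "(\<Sum>b\<in>S. weight (insert a S) (transpose a b \<circ> q)) =
      (\<Sum>c\<in>S. weight (insert a S) (transpose a (q c) \<circ> q))"
    using sum.permute[OF q, of "\<lambda>b. weight (insert a S) (transpose a b \<circ> q)"] by (simp add: o_def)
  also have "\<dots> = (\<Sum>c\<in>S. if c \<in> E then w else [:0, 1:] * w)"
    by (intro sum.cong c refl)
  also have "\<dots> = of_nat (card E) * w + of_nat (card S - card E) * ([:0, 1:] * w)"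
    using S(1) E(1) by (simp add: sum.If_cases Int_absorb1 card_Diff_subset finite_subset flip: Diff_eq)
  also have "of_nat (card S - card E) = (of_nat (card S) - of_nat (card E) :: int poly)"
    using card_mono[OF S(1) E(1)] by simp
  also have "- w + (of_nat (card E) * w + (of_nat (card S) - of_nat (card E)) * ([:0, 1:] * w)) =
      (of_nat (card S) * [:0, 1:] - 1) * w + (1 - [:0, 1:]) * ([:0, 1:] * pderiv w)"
    unfolding XD
    by (simp only: ring_distribs mult_1_left mult_1_right ac_simps minus_mult_left diff_conv_add_uminus)
  finally show ?thesis
    unfolding w_def by (simp only: ac_simps)
qed

section \<open>The signed excedance polynomial of all permutations\<close>

definition cycle_exc_poly :: "nat set \<Rightarrow> int poly" where
  "cycle_exc_poly A = (\<Sum>p | p permutes A. weight A p)"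

lemma cycle_exc_poly_empty: "cycle_exc_poly {} = 1"
  by (simp add: cycle_exc_poly_def weight_def num_cycles_def excedances_def)

lemma cycle_exc_poly_insert_max:
  assumes "finite S" "\<forall>x\<in>S. x < a"
  shows "cycle_exc_poly (insert a S) = (of_nat (card S) * [:0, 1:] - 1) * cycle_exc_poly S
    + [:0, 1:] * (1 - [:0, 1:]) * pderiv (cycle_exc_poly S)"
proof -
  have "a \<notin> S" using assms(2) by auto
  have "cycle_exc_poly (insert a S) =
      (\<Sum>q | q permutes S. \<Sum>b\<in>insert a S. weight (insert a S) (transpose a b \<circ> q))"
    unfolding cycle_exc_poly_def
    by (simp only: sum_over_permutations_insert[OF assms(1) \<open>a \<notin> S\<close>]) (rule sum.swap)
  also have "\<dots> = (\<Sum>q | q permutes S. (of_nat (card S) * [:0, 1:] - 1) * weight S q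
      + [:0, 1:] * (1 - [:0, 1:]) * pderiv (weight S q))"
    using assms by (intro sum.cong sum_weight_insert_max) auto
  finally show ?thesis
    unfolding cycle_exc_poly_def higher_pderiv_sum[of 1, simplified] sum.distrib sum_distrib_left .
qed

text \<open>Induction on the largest element. The empty set has value 1, which does not fit the
  formula, so the singleton serves as the real base case.\<close>

lemma cycle_exc_poly_eq:
  assumes "finite A" "A \<noteq> {}"
  shows "cycle_exc_poly A = - ([:- 1, 1:] ^ (card A - 1))"
  using assms
proof (induction A rule: finite_linorder_max_induct)
  case empty
  then show ?case by simp
next
  case (insert a S)
  let ?X = "[:0, 1:] :: int poly" and ?Y = "[:- 1, 1:] :: int poly"
  have Y: "?Y = ?X - 1" by (simp add: one_pCons)
  have rec: "cycle_exc_poly (insert a S) = (of_nat (card S) * ?X - 1) * cycle_exc_poly S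
      + ?X * (1 - ?X) * pderiv (cycle_exc_poly S)"
    using insert by (intro cycle_exc_poly_insert_max) auto
  show ?case
  proof (cases "S = {}")
    case True
    then show ?thesis using rec by (simp add: cycle_exc_poly_empty)
  next
    case False
    then obtain k where k: "card S = Suc k" using insert.hyps(1) by (metis card_0_eq not0_implies_Suc)
    have "a \<notin> S" using insert.hyps(2) by auto
    \<comment> \<open>The factor \<open>t - 1\<close> restores the exponent lowered by
      differentiation; for \<open>k = 0\<close> both sides vanish.\<close>
    have "(?X - 1) * pderiv (?Y ^ k) = of_nat k * ?Y ^ k"
      unfolding Y[symmetric]
      by (cases k) (simp_all only: pderiv_power_Suc, simp_all add: pderiv_pCons of_nat_poly)
    then have "?X * (1 - ?X) * pderiv (- (?Y ^ k)) = ?X * (of_nat k * ?Y ^ k)"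
      by (simp add: pderiv_minus algebra_simps)
    then have "cycle_exc_poly (insert a S) = - ((of_nat (Suc k) * ?X - 1) * ?Y ^ k) + ?X * (of_nat k * ?Y ^ k)"
      using rec insert.IH[OF False] k by simp
    also have "\<dots> = - (?Y ^ Suc k)"
      unfolding power_Suc by (simp only: of_nat_Suc Y) (simp add: algebra_simps)
    finally show ?thesis using insert.hyps(1) \<open>a \<notin> S\<close> k by simp
  qed
qed

section \<open>Increasing cycles and their composition with a permutation of the remaining
  points\<close>

lemma cyclic_on_rotate1:
  assumes "map p xs = rotate1 xs" "xs \<noteq> []"
  shows "cyclic_on p (set xs)"
proof (rule cyclic_on_singleI)
  let ?n = "length xs"
  have p: "p (xs ! i) = xs ! (Suc i mod ?n)" if "i < ?n" for i
    using that assms(1) by (metis nth_map nth_rotate1)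
  \<comment> \<open>Starting the orbit at the last entry makes the first step reach index 0, so the
    induction on the index needs no wrap-around.\<close>
  show "last xs \<in> set xs" using assms(2) by simp
  show "set xs = orbit p (last xs)"
  proof (intro set_eqI iffI)
    fix x assume "x \<in> set xs"
    then obtain i where "i < ?n" "x = xs ! i" by (auto simp: in_set_conv_nth)
    moreover have "xs ! i \<in> orbit p (last xs)" if "i < ?n" for i
      using that
    proof (induction i)
      case 0
      have "p (last xs) = xs ! 0"
        using p[of "?n - 1"] assms(2) by (simp add: last_conv_nth)
      then show ?case by (metis orbit.base)
    next
      case (Suc i)
      then have "p (xs ! i) = xs ! Suc i" using p[of i] by simp
      then show ?case using orbit.step[OF Suc.IH] Suc.prems by simp
    qed
    ultimately show "x \<in> orbit p (last xs)" by blast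
  next
    fix x assume "x \<in> orbit p (last xs)"
    moreover have "p y \<in> set xs" if "y \<in> set xs" for y
      using that assms(1) by (metis image_eqI set_map set_rotate1)
    ultimately show "x \<in> set xs"
      using assms(2) by induction auto
  qed
qed

text \<open>An entry of \<open>cs\<close> is never last in \<open>cs @ [m]\<close>, so its image is
  the next entry, without wrapping around.\<close>

lemma less_rotate1:
  assumes "map p (cs @ [m]) = rotate1 (cs @ [m])" "sorted_wrt (<) (cs @ [m])" "x \<in> set cs"
  shows "x < p x"
proof -
  let ?xs = "cs @ [m]"
  obtain i where i: "i < length cs" "x = cs ! i" using assms(3) by (auto simp: in_set_conv_nth)
  then have "p x = map p ?xs ! i" by (simp add: nth_append)
  also have "\<dots> = ?xs ! Suc i" unfolding assms(1) using i by (subst nth_rotate1) auto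
  finally have "p x = ?xs ! Suc i" .
  moreover have "?xs ! i < ?xs ! Suc i"
    using assms(2) i by (simp add: sorted_wrt_nth_less del: sorted_wrt_append)
  moreover have "?xs ! i = x" using i by (simp add: nth_append)
  ultimately show ?thesis by simp
qed

text \<open>For empty \<open>S\<close> this is the identity, matching the case in which
  \<open>m\<close> is a fixed point.\<close>

definition increasing_cycle :: "'a::linorder set \<Rightarrow> 'a \<Rightarrow> 'a \<Rightarrow> 'a" where
  "increasing_cycle S m = cycle_of_list (sorted_list_of_set S @ [m])"

lemma increasing_cycle_permutes:
  assumes "finite S"
  shows "increasing_cycle S m permutes insert m S"
  using cycle_permutes[of "sorted_list_of_set S @ [m]"] assms by (simp add: increasing_cycle_def)

lemma map_increasing_cycle:
  assumes "finite S" "m \<notin> S"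
  shows "map (increasing_cycle S m) (sorted_list_of_set S @ [m]) = rotate1 (sorted_list_of_set S @ [m])"
  using cyclic_rotation[of "sorted_list_of_set S @ [m]" 1] assms
  by (simp add: increasing_cycle_def del: rotate1.simps)

text \<open>The composite is the increasing cycle on \<open>insert m S\<close> and \<open>q\<close>
  on \<open>A - S\<close>, so cycles and excedances add up. The new cycle gives one sign and
  \<open>card S\<close> excedances: the elements of \<open>S\<close> move up along it, the maximum
  \<open>m\<close> does not.\<close>

lemma increasing_cycle_comp:
  assumes S: "finite A" "S \<subseteq> A" and m: "\<forall>x\<in>A. x < m" and q: "q permutes (A - S)"
  shows "weight (insert m A) (increasing_cycle S m \<circ> q) = - (monom 1 (card S) * weight (A - S) q)"
    and "orbit (increasing_cycle S m \<circ> q) m = insert m S"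
    and "increasing_cycle S m \<circ> q permutes insert m A"
    and "x \<in> insert m S \<Longrightarrow> (increasing_cycle S m \<circ> q) x = increasing_cycle S m x"
proof -
  let ?c = "increasing_cycle S m"
  let ?p = "?c \<circ> q" and ?cs = "sorted_list_of_set S"
  have fS: "finite S" using S finite_subset by auto
  have mA: "m \<notin> A" "m \<notin> S" using m S by auto
  have c: "?c permutes insert m S" by (rule increasing_cycle_permutes[OF fS])
  have p1: "?p x = ?c x" if "x \<in> insert m S" for x
    using permutes_not_in[OF q] that mA S by auto
  then show "x \<in> insert m S \<Longrightarrow> ?p x = ?c x" .
  have p2: "?p x = q x" if "x \<in> A - S" for x
    using permutes_not_in[OF c, of "q x"] permutes_in_image[OF q, of x] that mA by auto
  show p: "?p permutes insert m A"
    by (rule permutes_compose[OF permutes_subset[OF q] permutes_subset[OF c]]) (use S in auto)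
  have "map ?p (?cs @ [m]) = map ?c (?cs @ [m])"
    using fS p1 by (intro map_cong) auto
  then have rot: "map ?p (?cs @ [m]) = rotate1 (?cs @ [m])"
    using map_increasing_cycle[OF fS mA(2)] by (simp only:)
  have "cyclic_on ?p (insert m S)"
    using cyclic_on_rotate1[OF rot] fS by simp
  then have orb: "orbit ?p x = insert m S" if "x \<in> insert m S" for x
    using that by (rule orbit_cyclic_eq3)
  then show "orbit ?p m = insert m S" by simp
  have orbq: "orbit ?p x = orbit q x" if "x \<in> A - S" for x
  proof (rule orbit_cong)
    show "x \<in> orbit q x"
      using q S by (intro permutation_self_in_orbit) (auto simp: permutation_permutes)
    show "?p s = q s" if "s \<in> orbit q x" for s
      using p2 permutes_orbit_subset[OF q \<open>x \<in> A - S\<close>] that by blast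
  qed
  have "insert m A = insert m S \<union> (A - S)" using S by auto
  then have "orbit ?p ` insert m A = orbit ?p ` insert m S \<union> orbit ?p ` (A - S)"
    by (simp only: image_Un)
  also have "orbit ?p ` insert m S = {insert m S}" using orb by auto
  also have "orbit ?p ` (A - S) = orbit q ` (A - S)" using orbq by (intro image_cong) auto
  finally have "orbit ?p ` insert m A = insert (insert m S) (orbit q ` (A - S))"
    by (simp only: Un_insert_left Un_empty_left)
  moreover have "insert m S \<notin> orbit q ` (A - S)"
    using permutes_orbit_subset[OF q] mA by blast
  ultimately have cyc: "num_cycles (insert m A) ?p = Suc (num_cycles (A - S) q)"
    using S by (simp add: num_cycles_def)
  have "sorted_wrt (<) (?cs @ [m])"
    using fS m S by (auto simp: sorted_wrt_append)
  then have "x < ?p x" if "x \<in> S" for x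
    using less_rotate1[OF rot] that fS by simp
  moreover have "\<not> m < ?p m"
    using permutes_in_image[OF p, of m] m by (auto simp del: o_apply)
  ultimately have "{i \<in> insert m A. i < ?p i} = S \<union> {i \<in> A - S. i < q i}"
    using p2 S by auto
  moreover have "card (S \<union> {i \<in> A - S. i < q i}) = card S + card {i \<in> A - S. i < q i}"
    using fS S by (intro card_Un_disjoint) auto
  ultimately have "excedances (insert m A) ?p = card S + excedances (A - S) q"
    by (simp add: excedances_def)
  then show "weight (insert m A) ?p = - (monom 1 (card S) * weight (A - S) q)"
    by (simp add: weight_def cyc mult_monom minus_monom)
qed

section \<open>Decomposition of \<open>qhat_set\<close> and its generating polynomial\<close>

definition qhat_set :: "nat set \<Rightarrow> nat \<Rightarrow> (nat \<Rightarrow> nat) set" where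
  "qhat_set A m = {p. p permutes insert m A \<and>
     (\<exists>cs. distinct (cs @ [m]) \<and> map p (cs @ [m]) = rotate1 (cs @ [m]) \<and> sorted_wrt (<) cs)}"

text \<open>The orbit of \<open>m\<close> is \<open>insert m S\<close>, which recovers
  \<open>S\<close>. The increasing order then leaves only one possible cycle, and cancelling it
  recovers \<open>q\<close>.\<close>

lemma bij_betw_qhat_set:
  assumes A: "finite A" and m: "\<forall>x\<in>A. x < m"
  shows "bij_betw (\<lambda>(S, q). increasing_cycle S m \<circ> q)
    (SIGMA S:Pow A. {q. q permutes (A - S)}) (qhat_set A m)"
  unfolding bij_betw_def
proof
  note comp = increasing_cycle_comp[OF A _ m]
  have mA: "m \<notin> A" using m by auto
  show "inj_on (\<lambda>(S, q). increasing_cycle S m \<circ> q) (SIGMA S:Pow A. {q. q permutes (A - S)})"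
  proof (rule inj_onI; clarify)
    fix S q T r
    assume S: "S \<subseteq> A" "T \<subseteq> A" and q: "q permutes (A - S)" "r permutes (A - T)"
      and eq: "increasing_cycle S m \<circ> q = increasing_cycle T m \<circ> r"
    have "insert m S = insert m T"
      using comp(2)[OF S(1) q(1)] comp(2)[OF S(2) q(2)] eq by simp
    moreover have "m \<notin> S" "m \<notin> T" using S mA by auto
    ultimately have ST: "S = T" by (simp add: insert_ident)
    have "inj (increasing_cycle S m)"
      using increasing_cycle_permutes[OF finite_subset[OF S(1) A]] by (rule permutes_inj)
    then have "q = r" using eq ST by (simp add: fun.inj_map_strong inj_def fun_eq_iff)
    then show "S = T \<and> q = r" using ST by simp
  qed
  show "(\<lambda>(S, q). increasing_cycle S m \<circ> q) ` (SIGMA S:Pow A. {q. q permutes (A - S)}) = qhat_set A m"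
  proof (intro equalityI subsetI)
    fix p assume "p \<in> (\<lambda>(S, q). increasing_cycle S m \<circ> q) ` (SIGMA S:Pow A. {q. q permutes (A - S)})"
    then obtain S q where S: "S \<subseteq> A" and q: "q permutes (A - S)" and p: "p = increasing_cycle S m \<circ> q"
      by auto
    have fS: "finite S" using S A by (rule finite_subset)
    have mS: "m \<notin> S" using S mA by auto
    let ?cs = "sorted_list_of_set S"
    have "map p (?cs @ [m]) = map (increasing_cycle S m) (?cs @ [m])"
      unfolding p using comp(4)[OF S q] fS by (intro map_cong) auto
    then have "map p (?cs @ [m]) = rotate1 (?cs @ [m])"
      using map_increasing_cycle[OF fS mS] by (simp only:)
    then show "p \<in> qhat_set A m"
      unfolding qhat_set_def using comp(3)[OF S q] fS mS p
      by (auto intro!: exI[of _ ?cs] simp del: rotate1.simps map_append)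
  next
    fix p assume "p \<in> qhat_set A m"
    then obtain cs where p: "p permutes insert m A" and cs: "distinct (cs @ [m])" "sorted_wrt (<) cs"
      and rot: "map p (cs @ [m]) = rotate1 (cs @ [m])"
      by (auto simp: qhat_set_def)
    define S where "S = set cs"
    have "cyclic_on p (insert m S)" using cyclic_on_rotate1[OF rot] by (simp add: S_def)
    then have "insert m S = orbit p m" by (simp add: orbit_cyclic_eq3)
    then have "S \<subseteq> insert m A" using permutes_orbit_subset[OF p, of m] by auto
    then have S: "S \<subseteq> A" using cs(1) by (auto simp: S_def)
    have csS: "cs = sorted_list_of_set S"
      using cs by (simp add: S_def sorted_list_of_set.idem_if_sorted_distinct strict_sorted_iff)
    have fS: "finite S" by (simp add: S_def)
    let ?c = "increasing_cycle S m"
    have c: "?c permutes insert m S" by (rule increasing_cycle_permutes[OF fS])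
    have "m \<notin> S" using S mA by auto
    have "map ?c (cs @ [m]) = rotate1 (cs @ [m])"
      using map_increasing_cycle[OF fS \<open>m \<notin> S\<close>] unfolding csS[symmetric] .
    then have "map p (cs @ [m]) = map ?c (cs @ [m])"
      using rot by (rule trans[OF _ sym, rotated])
    then have pc: "p x = ?c x" if "x \<in> insert m S" for x
      using that by (auto simp: S_def)
    \<comment> \<open>Since \<open>p\<close> agrees with the increasing cycle on
      \<open>insert m S\<close>, undoing that cycle fixes these points and leaves a permutation of
      the rest.\<close>
    have "inv ?c \<circ> p permutes (A - S)"
    proof (rule permutes_superset)
      show "inv ?c \<circ> p permutes insert m A"
        by (rule permutes_compose[OF p permutes_subset[OF permutes_inv[OF c]]]) (use S in auto)
      show "(inv ?c \<circ> p) x = x" if "x \<in> insert m A - (A - S)" for x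
        using pc[of x] that permutes_inverses(2)[OF c] by auto
    qed
    moreover have "p = ?c \<circ> (inv ?c \<circ> p)"
      using permutes_inverses(1)[OF c] by (simp add: fun_eq_iff)
    ultimately show "p \<in> (\<lambda>(S, q). increasing_cycle S m \<circ> q) ` (SIGMA S:Pow A. {q. q permutes (A - S)})"
      using S by (intro image_eqI[of _ _ "(S, inv ?c \<circ> p)"]) auto
  qed
qed

text \<open>The factor \<open>t - 1\<close> turns the exponent \<open>card (A - S) - 1\<close> from
  \<open>cycle_exc_poly_eq\<close> into \<open>card (A - S)\<close>, so that the sum over
  \<open>S\<close> becomes a binomial expansion.\<close>

lemma sum_weight_qhat_set:
  assumes A: "finite A" and m: "\<forall>x\<in>A. x < m"
  shows "[:- 1, 1:] * (\<Sum>p\<in>qhat_set A m. weight (insert m A) p) = [:- 1, 2:] ^ card A - [:0, 1:] ^ Suc (card A)"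
proof -
  let ?X = "[:0, 1:] :: int poly" and ?Y = "[:- 1, 1:] :: int poly"
  have "(\<Sum>p\<in>qhat_set A m. weight (insert m A) p) =
      (\<Sum>(S, q)\<in>(SIGMA S:Pow A. {q. q permutes (A - S)}). weight (insert m A) (increasing_cycle S m \<circ> q))"
    using sum.reindex_bij_betw[OF bij_betw_qhat_set[OF A m], of "weight (insert m A)"]
    by (simp add: case_prod_beta)
  also have "\<dots> = (\<Sum>S\<in>Pow A. \<Sum>q | q permutes (A - S). weight (insert m A) (increasing_cycle S m \<circ> q))"
    using A by (subst sum.Sigma) (auto intro: finite_permutations)
  also have "\<dots> = (\<Sum>S\<in>Pow A. - (?X ^ card S * cycle_exc_poly (A - S)))"
    using increasing_cycle_comp(1)[OF A _ m]
    by (intro sum.cong)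
      (auto simp: cycle_exc_poly_def sum_distrib_left sum_negf monom_altdef)
  finally have "?Y * (\<Sum>p\<in>qhat_set A m. weight (insert m A) p)
      = (\<Sum>S\<in>Pow A. ?X ^ card S * (- ?Y * cycle_exc_poly (A - S)))"
    by (simp only: sum_distrib_left mult_minus_left mult_minus_right ac_simps)
  \<comment> \<open>Only \<open>S = A\<close> is exceptional: its complement is empty, so the second
    factor is \<open>1 - t\<close> instead of 1, and the difference is the correction term.\<close>
  also have "\<dots> = (\<Sum>S\<in>Pow A. ?X ^ card S * ?Y ^ card (A - S) - (if S = A then ?X ^ Suc (card A) else 0))"
  proof (rule sum.cong)
    fix S assume "S \<in> Pow A"
    show "?X ^ card S * (- ?Y * cycle_exc_poly (A - S)) =
        ?X ^ card S * ?Y ^ card (A - S) - (if S = A then ?X ^ Suc (card A) else 0)"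
    proof (cases "S = A")
      case True
      have "- ?Y = 1 - ?X" by (simp add: one_pCons)
      then show ?thesis using True by (simp only:) (simp add: cycle_exc_poly_empty algebra_simps)
    next
      case False
      then have "A - S \<noteq> {}" "finite (A - S)" using \<open>S \<in> Pow A\<close> A by auto
      then have "- ?Y * cycle_exc_poly (A - S) = ?Y ^ Suc (card (A - S) - 1)"
        by (simp add: cycle_exc_poly_eq)
      also have "Suc (card (A - S) - 1) = card (A - S)"
        using \<open>A - S \<noteq> {}\<close> \<open>finite (A - S)\<close> by (simp add: card_gt_0_iff)
      finally show ?thesis using False by simp
    qed
  qed auto
  \<comment> \<open>Expanding the product, \<open>S\<close> is the set of factors from which
    \<open>?X\<close> is chosen.\<close>
  also have "\<dots> = (\<Prod>x\<in>A. ?X + ?Y) - ?X ^ Suc (card A)"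
    unfolding sum_subtractf prod_add[OF A] using A by simp
  also have "(\<Prod>x\<in>A. ?X + ?Y) = [:- 1, 2:] ^ card A" by simp
  finally show ?thesis .
qed

section \<open>The recurrence for \<open>B\<close> and comparison of coefficients\<close>

lemma B_add_B_Suc:
  assumes "k \<le> n"
  shows "B n k + B n (Suc k) = 2 ^ (n - k) * int (n choose k)"
proof -
  have "B n k = 2 ^ (n - k) * int (n choose k)
      + (\<Sum>i=Suc k..n. (- 1) ^ (i - k) * 2 ^ (n - i) * int (n choose i))"
    using assms by (simp add: B_def sum.atLeast_Suc_atMost)
  \<comment> \<open>Measuring the exponent from \<open>Suc k\<close> instead of \<open>k\<close>
    reverses every sign.\<close>
  also have "(\<Sum>i=Suc k..n. (- 1) ^ (i - k) * 2 ^ (n - i) * int (n choose i)) = - B n (Suc k)"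
    unfolding B_def sum_negf[symmetric]
    by (intro sum.cong) (auto simp: Suc_diff_le dest!: Suc_diff_le)
  finally show ?thesis by simp
qed

text \<open>Downward induction from \<open>k = n\<close>. Multiplication by \<open>t - 1\<close>
  produces differences of neighbouring coefficients of \<open>G\<close>; the alternating sign turns
  these into the sums of \<open>B_add_B_Suc\<close>.\<close>

lemma B_conv_coeff:
  fixes G :: "int poly"
  assumes G: "[:- 1, 1:] * G = [:- 1, 2:] ^ n - [:0, 1:] ^ Suc n" and "k \<le> n"
  shows "B n k = (- 1) ^ Suc k * coeff G (n - k)"
  using \<open>k \<le> n\<close>
proof (induction k rule: inc_induct)
  case base
  have "- coeff G 0 = coeff ([:- 1, 1:] * G) 0" by simp
  also have "\<dots> = (- 1) ^ n"
    unfolding G by (simp add: coeff_0_power)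
  finally have G0: "coeff G 0 = - ((- 1) ^ n)" by linarith
  show ?case unfolding diff_self_eq_0 G0 by (simp add: B_def)
next
  case (step k)
  define d where "d = n - Suc k"
  have d: "n - k = Suc d" "n - Suc k = d" "Suc d \<le> n" "n - Suc d = k"
    using step.hyps by (simp_all add: d_def)
  have "coeff G d - coeff G (Suc d) = coeff ([:- 1, 1:] * G) (Suc d)"
    by simp
  also have "\<dots> = coeff ([:- 1, 2:] ^ n) (Suc d) - coeff (monom 1 (Suc n)) (Suc d)"
    unfolding G by (simp add: monom_altdef)
  \<comment> \<open>The correction monomial has degree \<open>n + 1\<close>, above the degree
    compared here.\<close>
  also have "coeff (monom (1::int) (Suc n)) (Suc d) = 0"
    using d(3) by simp
  also have "coeff ([:- 1, 2:] ^ n) (Suc d) = int (n choose Suc d) * 2 ^ Suc d * (- 1) ^ k"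
    using coeff_linear_poly_power[OF d(3)] unfolding d(4) .
  also have "n choose Suc d = n choose k"
    using binomial_symmetric[of k n] step.hyps unfolding d(1) by simp
  finally have G': "coeff G (Suc d) = coeff G d - int (n choose k) * 2 ^ Suc d * (- 1) ^ k" by linarith
  have "B n k = 2 ^ Suc d * int (n choose k) - B n (Suc k)"
    using B_add_B_Suc[of k n] step.hyps unfolding d(1) by linarith
  also have "\<dots> = 2 ^ Suc d * int (n choose k) - (- 1) ^ k * coeff G d"
    unfolding step.IH d(2) by simp
  also have "\<dots> = (- 1) ^ Suc k * coeff G (Suc d)"
    unfolding G' by (simp add: right_diff_distrib)
  finally show ?case unfolding d(1) .
qed

theorem theorem3p4:
  fixes n k :: nat
  assumes "k \<le> n"
  shows "B n k = (\<Sum>p \<in> {p \<in> Qhat (n + 1). exc (n + 1) p = n - k}.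
                   (-1) ^ (cyc (n + 1) p + aexc (n + 1) p))"
proof -
  let ?w = "\<lambda>p. weight {1..n + 1} p"
  have A: "{1..n + 1} = insert (n + 1) {1..n}" by auto
  have Q: "Qhat (n + 1) = qhat_set {1..n} (n + 1)"
    unfolding Qhat_def qhat_set_def A ..
  have "[:- 1, 1:] * (\<Sum>p\<in>Qhat (n + 1). ?w p) = [:- 1, 2:] ^ n - [:0, 1:] ^ Suc n"
    using sum_weight_qhat_set[of "{1..n}" "n + 1"] unfolding Q A by simp
  then have "B n k = (- 1) ^ Suc k * coeff (\<Sum>p\<in>Qhat (n + 1). ?w p) (n - k)"
    using assms by (rule B_conv_coeff)
  \<comment> \<open>The coefficient at degree \<open>n - k\<close> picks out the permutations with
    \<open>n - k\<close> excedances.\<close>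
  also have "\<dots> = (\<Sum>p\<in>Qhat (n + 1). if exc (n + 1) p = n - k then (- 1) ^ (cyc (n + 1) p + Suc k) else 0)"
    unfolding coeff_sum sum_distrib_left
    by (intro sum.cong) (simp_all add: weight_def power_add exc_def cyc_def excedances_def num_cycles_def)
  also have "\<dots> = (\<Sum>p\<in>{p \<in> Qhat (n + 1). exc (n + 1) p = n - k}. (- 1) ^ (cyc (n + 1) p + Suc k))"
  proof (rule sum.inter_filter[symmetric])
    show "finite (Qhat (n + 1))"
      by (rule finite_subset[OF _ finite_permutations[of "{1..n + 1}"]]) (auto simp: Qhat_def)
  qed
  \<comment> \<open>Here \<open>aexc\<close> is \<open>(n + 1) - (n - k) = k + 1\<close>, which is
    the exponent of the constant sign.\<close>
  also have "\<dots> = (\<Sum>p\<in>{p \<in> Qhat (n + 1). exc (n + 1) p = n - k}. (- 1) ^ (cyc (n + 1) p + aexc (n + 1) p))"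
  proof (rule sum.cong)
    fix p assume "p \<in> {p \<in> Qhat (n + 1). exc (n + 1) p = n - k}"
    have "{1..n + 1} = {i \<in> {1..n + 1}. i < p i} \<union> {i \<in> {1..n + 1}. p i \<le> i}" by auto
    then have "card {1..n + 1} = exc (n + 1) p + aexc (n + 1) p"
      unfolding exc_def aexc_def by (metis (no_types, lifting) card_Un_disjoint disjoint_iff
        finite_Un finite_atLeastAtMost leD mem_Collect_eq)
    then have "aexc (n + 1) p = Suc k"
      using \<open>p \<in> _\<close> assms by simp
    then show "(- 1) ^ (cyc (n + 1) p + Suc k) = ((- 1) ^ (cyc (n + 1) p + aexc (n + 1) p) :: int)"
      by simp
  qed simp
  finally show ?thesis .
qed

end
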